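(* There exists an absolute constant $\kappa_2>0$ such that the following holds. Let $\mathcal{G}$ be a class of classifiers $g:\mathbb{R}^d\to\{0,1\}$ with finite VC dimension $V$, let $n\ge 1$ be an integer, $h\in(0,1]$ and $e_m\in(0,1]$. Suppose $V\ge 2$ and $n e_m\ge V$. Suppose that the propensity $e:\mathbb{R}^d\to(0,1]$ satisfies $e(x)\ge e_m$ for all $x\in\mathbb{R}^d$, and that for every $\varepsilon>0$ there exist $(x_1,\dots,x_V)\in(\mathbb{R}^d)^V$ shattered by $\mathcal{G}$ such that $$\sup_{i\in\{1,\dots,V\}}e(x_i)\le e_m+\varepsilon.$$ Let $h'=\sqrt{\frac{V}{n e_m}}$. Then the minimax risk $\mathcal{R}(\mathcal{G},h)$ satisfies: 1. if $h\ge h'$, then $\displaystyle \mathcal{R}(\mathcal{G},h)\ge\kappa_2\,\frac{V-1}{h\,n\,e_m}$; 2. if $h\le h'$, then $\displaystyle \mathcal{R}(\mathcal{G},h)\ge\kappa_2\sqrt{\frac{V-1}{n\,e_m}}$.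
   Context: Positive-unlabeled model: given a distribution $\mathbb{P}$ of $(X,Y)$ on $\mathbb{R}^d\times\{0,1\}$ and a (measurable) propensity function $e:\mathbb{R}^d\to(0,1]$, the observed label $S\in\{0,1\}$ satisfies $\mathbb{P}(S=1\mid Y=1,X=x)=e(x)$ and $\mathbb{P}(S=1\mid Y=0,X=x)=0$. The training sample consists of i.i.d. copies $(X_1,S_1),\dots,(X_n,S_n)$ of $(X,S)$; the classes $Y_i$ are not observed. Let $\eta(x)=\mathbb{P}(Y=1\mid X=x)$, $g^*(x)=\mathbf{1}_{\eta(x)\ge1/2}$ (Bayes classifier), $R(g)=\mathbb{P}(g(X)\ne Y)$ and $\ell(g,g^* )=R(g)-R(g^* )$. $\mathcal{P}(\mathcal{G},h)$ is the set of probability distributions $\mathbb{P}$ of $(X,Y)$ on $\mathbb{R}^d\times\{0,1\}$ such that $g^*\in\mathcal{G}$ and $|2\eta(x)-1|\ge h$ for every $x\in\mathbb{R}^d$. Since $\eta$ is determined by $\mathbb{P}$ only up to null sets of the law of $X$, this means that these two properties hold for some version of $\eta$. The minimax risk (for the given fixed propensity $e$) is $$\mathcal{R}(\mathcal{G},h)=\inf_{\widehat g\in\mathcal{G}}\ \sup_{\mathbb{P}\in\mathcal{P}(\mathcal{G},h)}\mathbb{E}\left[\ell(\widehat g,g^* )\right],$$ where the infimum is over all (measurable) functions $\widehat g$ of the sample $(X_i,S_i)_{1\le i\le n}$ with values in $\mathcal{G}$, and the expectation is over the sample (drawn under $\mathbb{P}$ and the propensity $e$). Points $x_1,\dots,x_v\in\mathbb{R}^d$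 are shattered by $\mathcal{G}$ if $|\{(g(x_1),\dots,g(x_v)):g\in\mathcal{G}\}|=2^v$; the VC dimension $V$ of $\mathcal{G}$ is the largest $v$ for which $v$ shattered points exist. "Absolute constant" means it depends on none of the other objects. *)

theory Defs
  imports "HOL-Probability.Probability"
begin

text \<open>
  The space of dimension \<open>d\<close> is the product of \<open>d\<close> copies of the Borel line, its points being
  the functions that are undefined outside \<open>{..<d}\<close>.  A type-indexed dimension could not be
  quantified inside the scope of an absolute constant.  Labels are Booleans (\<open>True\<close> is 1).
\<close>

type_synonym point = "nat \<Rightarrow> real"

definition Rd :: "nat \<Rightarrow> point measure" where
  "Rd d = Pi\<^sub>M {..<d} (\<lambda>_. borel)"

definition labelled :: "nat \<Rightarrow> (point \<times> bool) measure" where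
  "labelled d = Rd d \<Otimes>\<^sub>M count_space UNIV"

text \<open>Classifiers are extensional, so that equality of classifiers is equality on the space.\<close>

definition classifiers :: "nat \<Rightarrow> (point \<Rightarrow> bool) set" where
  "classifiers d = measurable (Rd d) (count_space UNIV) \<inter> extensional (space (Rd d))"

definition shattered ::
    "nat \<Rightarrow> (point \<Rightarrow> bool) set \<Rightarrow> nat \<Rightarrow> (nat \<Rightarrow> point) \<Rightarrow> bool" where
  "shattered d G v x \<longleftrightarrow>
     (\<forall>i<v. x i \<in> space (Rd d)) \<and>
     card ((\<lambda>g. \<lambda>i\<in>{..<v}. g (x i)) ` G) = 2 ^ v"

definition has_VC_dim :: "nat \<Rightarrow> (point \<Rightarrow> bool) set \<Rightarrow> nat \<Rightarrow> bool" where
  "has_VC_dim d G V \<longleftrightarrow>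
     (\<exists>x. shattered d G V x) \<and> (\<forall>v. (\<exists>x. shattered d G v x) \<longrightarrow> v \<le> V)"

definition distributions :: "nat \<Rightarrow> (point \<times> bool) measure set" where
  "distributions d = {P. prob_space P \<and> sets P = sets (labelled d)}"

text \<open>\<open>\<eta>\<close> is a version of the conditional probability \<open>x \<mapsto> P(Y = 1 | X = x)\<close>.\<close>

definition regression_version ::
    "nat \<Rightarrow> (point \<times> bool) measure \<Rightarrow> (point \<Rightarrow> real) \<Rightarrow> bool" where
  "regression_version d P \<eta> \<longleftrightarrow>
     \<eta> \<in> borel_measurable (Rd d) \<and>
     (\<forall>x\<in>space (Rd d). 0 \<le> \<eta> x \<and> \<eta> x \<le> 1) \<and>
     (\<forall>A\<in>sets (Rd d). measure P (A \<times> {True}) = (\<integral>(x, y). indicator A x * \<eta> x \<partial>P))"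

definition bayes :: "nat \<Rightarrow> (point \<Rightarrow> real) \<Rightarrow> point \<Rightarrow> bool" where
  "bayes d \<eta> = (\<lambda>x\<in>space (Rd d). \<eta> x \<ge> 1 / 2)"

definition risk :: "(point \<times> bool) measure \<Rightarrow> (point \<Rightarrow> bool) \<Rightarrow> real" where
  "risk P g = measure P {(x, y) \<in> space P. g x \<noteq> y}"

text \<open>Versions agree almost everywhere, so the risk of the Bayes classifier does not depend on
  the version selected here.\<close>

definition excess_risk :: "nat \<Rightarrow> (point \<times> bool) measure \<Rightarrow> (point \<Rightarrow> bool) \<Rightarrow> real" where
  "excess_risk d P g = risk P g - risk P (bayes d (SOME \<eta>. regression_version d P \<eta>))"

definition margin_class ::
    "nat \<Rightarrow> (point \<Rightarrow> bool) set \<Rightarrow> real \<Rightarrow> (point \<times> bool) measure set" where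
  "margin_class d G h =
     {P \<in> distributions d. \<exists>\<eta>. regression_version d P \<eta> \<and> bayes d \<eta> \<in> G \<and>
        (\<forall>x\<in>space (Rd d). \<bar>2 * \<eta> x - 1\<bar> \<ge> h)}"

text \<open>Joint law of \<open>((X, Y), S)\<close>: given \<open>X = x\<close> and \<open>Y = y\<close>, the observed label \<open>S\<close> is Bernoulli
  with parameter \<open>e x\<close> if \<open>y = 1\<close> and \<open>0\<close> if \<open>y = 0\<close>.\<close>

definition pu_joint_law ::
    "(point \<Rightarrow> real) \<Rightarrow> (point \<times> bool) measure \<Rightarrow> ((point \<times> bool) \<times> bool) measure" where
  "pu_joint_law e P = density (P \<Otimes>\<^sub>M count_space UNIV)
     (\<lambda>((x, y), s). ennreal (pmf (bernoulli_pmf (if y then e x else 0)) s))"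

definition pu_law ::
    "nat \<Rightarrow> (point \<Rightarrow> real) \<Rightarrow> (point \<times> bool) measure \<Rightarrow> (point \<times> bool) measure" where
  "pu_law d e P = distr (pu_joint_law e P) (labelled d) (\<lambda>((x, y), s). (x, s))"

text \<open>
  An estimator is measurable when its risk is a measurable function of the sample under every
  distribution, that is, for the sigma-algebra on \<open>G\<close> generated by the risks.  Every
  estimator such that \<open>(D, x) \<mapsto> f D x\<close> is jointly measurable satisfies this.
\<close>

definition estimators ::
    "nat \<Rightarrow> nat \<Rightarrow> (point \<Rightarrow> bool) set \<Rightarrow> ((nat \<Rightarrow> point \<times> bool) \<Rightarrow> point \<Rightarrow> bool) set" where
  "estimators d n G =
     {f \<in> space (Pi\<^sub>M {..<n} (\<lambda>_. labelled d)) \<rightarrow> G.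
        \<forall>P\<in>distributions d.
          (\<lambda>D. risk P (f D)) \<in> borel_measurable (Pi\<^sub>M {..<n} (\<lambda>_. labelled d))}"

definition minimax_risk ::
    "nat \<Rightarrow> nat \<Rightarrow> (point \<Rightarrow> real) \<Rightarrow> (point \<Rightarrow> bool) set \<Rightarrow> real \<Rightarrow> ereal" where
  "minimax_risk d n e G h =
     (INF f\<in>estimators d n G. SUP P\<in>margin_class d G h.
        ereal (\<integral>D. excess_risk d P (f D) \<partial>(Pi\<^sub>M {..<n} (\<lambda>_. pu_law d e P))))"

end

theory Submission
  imports Defs
begin

text \<open>
  The lower bound follows from Assouad's method.  Take \<open>V\<close> shattered points with propensity at most
  \<open>2 e\<^sub>m\<close>.  Put mass \<open>p\<close> on \<open>V - 1\<close> of them and the remaining mass on the last one.  Since the points are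
  shattered, every labelling \<open>B\<close> of the \<open>V - 1\<close> points is realized by a classifier in \<open>G\<close>, and letting the
  regression function be \<open>(1 + h) / 2\<close> or \<open>(1 - h) / 2\<close> according to this classifier gives a distribution
  with margin \<open>h\<close> and Bayes classifier in \<open>G\<close>.  Misclassifying one of the points costs \<open>p h\<close>.

  Observing the label \<open>S\<close> at a point of propensity \<open>e\<close> amounts to distinguishing the Bernoulli
  parameters \<open>e (1 + h) / 2\<close> and \<open>e (1 - h) / 2\<close>, whose affinity is at least \<open>1 - e h\<^sup>2\<close>
  (\<open>bernoulli_affinity\<close>).  Changing one bit of the labelling thus lowers the affinity of two samples of
  size \<open>n\<close> to no less than \<open>(1 - 2 p e\<^sub>m h\<^sup>2) ^ n\<close>, which is at least \<open>1 / 2\<close> for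
  \<open>p = 1 / (4 n e\<^sub>m h\<^sup>2)\<close>.  With this \<open>p\<close> the labelling cannot be recovered, and \<open>assouad\<close> yields a
  risk of order \<open>(V - 1) p h\<close>, that is \<open>(V - 1) / (n e\<^sub>m h)\<close>.

  The total mass \<open>(V - 1) p\<close> must not exceed 1, which holds when \<open>h \<ge> h'\<close>.  For \<open>h \<le> h'\<close> the class of
  distributions contains the one of margin \<open>h'\<close>, and the bound for \<open>h'\<close> is of order
  \<open>(V - 1) / sqrt (V n e\<^sub>m)\<close>, which is comparable to \<open>sqrt ((V - 1) / (n e\<^sub>m))\<close> as \<open>V \<ge> 2\<close>.
\<close>

section \<open>Affinity and Assouad's lemma\<close>

text \<open>
  The sum of the minima is the least sum of the two errors of a test between \<open>a\<close> and \<open>c\<close>.  Since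
  \<open>a c = max a c * min a c\<close> and the maxima sum to at most 2, the bound is the Cauchy-Schwarz
  inequality.  The affinity is preferred to the total variation because it is multiplicative
  over independent observations.
\<close>

lemma affinity_le_sum_min:
  fixes a c :: "'a \<Rightarrow> real"
  assumes "\<And>\<omega>. \<omega> \<in> \<Omega> \<Longrightarrow> 0 \<le> a \<omega>" "\<And>\<omega>. \<omega> \<in> \<Omega> \<Longrightarrow> 0 \<le> c \<omega>"
    and "sum a \<Omega> \<le> 1" "sum c \<Omega> \<le> 1"
  shows "(\<Sum>\<omega>\<in>\<Omega>. sqrt (a \<omega> * c \<omega>))\<^sup>2 \<le> 2 * (\<Sum>\<omega>\<in>\<Omega>. min (a \<omega>) (c \<omega>))"
proof -
  have "(\<Sum>\<omega>\<in>\<Omega>. sqrt (a \<omega> * c \<omega>))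
      = (\<Sum>\<omega>\<in>\<Omega>. sqrt (max (a \<omega>) (c \<omega>)) * sqrt (min (a \<omega>) (c \<omega>)))"
    by (intro sum.cong refl) (auto simp: real_sqrt_mult max_def min_def)
  also have "\<dots>\<^sup>2 \<le> (\<Sum>\<omega>\<in>\<Omega>. (sqrt (max (a \<omega>) (c \<omega>)))\<^sup>2) * (\<Sum>\<omega>\<in>\<Omega>. (sqrt (min (a \<omega>) (c \<omega>)))\<^sup>2)"
    by (rule Cauchy_Schwarz_ineq_sum)
  also have "\<dots> = (\<Sum>\<omega>\<in>\<Omega>. max (a \<omega>) (c \<omega>)) * (\<Sum>\<omega>\<in>\<Omega>. min (a \<omega>) (c \<omega>))"
    using assms(1,2) by (intro arg_cong2[where f = "(*)"] sum.cong refl) (auto simp: le_max_iff_disj)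
  also have "\<dots> \<le> 2 * (\<Sum>\<omega>\<in>\<Omega>. min (a \<omega>) (c \<omega>))"
  proof (rule mult_right_mono)
    have "(\<Sum>\<omega>\<in>\<Omega>. max (a \<omega>) (c \<omega>)) \<le> (\<Sum>\<omega>\<in>\<Omega>. a \<omega> + c \<omega>)"
      using assms(1,2) by (intro sum_mono) auto
    then show "(\<Sum>\<omega>\<in>\<Omega>. max (a \<omega>) (c \<omega>)) \<le> 2"
      using assms(3,4) by (simp add: sum.distrib)
    show "0 \<le> (\<Sum>\<omega>\<in>\<Omega>. min (a \<omega>) (c \<omega>))"
      using assms(1,2) by (intro sum_nonneg) auto
  qed
  finally show ?thesis .
qed

lemma sqrt_prod_lessThan: "sqrt (\<Prod>i<n. f i) = (\<Prod>i<n. sqrt (f i))" for n :: nat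
  by (induction n) (simp_all add: real_sqrt_mult)

lemma affinity_power:
  fixes a c :: "'a \<Rightarrow> real"
  assumes "finite A"
  shows "(\<Sum>\<omega>\<in>{..<n} \<rightarrow>\<^sub>E A. sqrt ((\<Prod>i<n. a (\<omega> i)) * (\<Prod>i<n. c (\<omega> i))))
    = (\<Sum>t\<in>A. sqrt (a t * c t)) ^ n"
proof -
  have "(\<Sum>\<omega>\<in>{..<n} \<rightarrow>\<^sub>E A. sqrt ((\<Prod>i<n. a (\<omega> i)) * (\<Prod>i<n. c (\<omega> i))))
      = (\<Sum>\<omega>\<in>{..<n} \<rightarrow>\<^sub>E A. \<Prod>i<n. sqrt (a (\<omega> i) * c (\<omega> i)))"
    by (simp add: sqrt_prod_lessThan prod.distrib real_sqrt_mult)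
  also have "\<dots> = (\<Prod>i<n. \<Sum>t\<in>A. sqrt (a t * c t))"
    using assms by (intro prod_sum_PiE[symmetric]) auto
  finally show ?thesis by simp
qed

definition flip :: "'a \<Rightarrow> 'a set \<Rightarrow> 'a set" where
  "flip u B = (if u \<in> B then B - {u} else insert u B)"

lemma mem_flip_iff: "v \<in> flip u B \<longleftrightarrow> (if v = u then u \<notin> B else v \<in> B)"
  by (auto simp: flip_def)

lemma sum_Pow_flip:
  fixes F :: "'a set \<Rightarrow> real"
  assumes "u \<in> T"
  shows "(\<Sum>B\<in>Pow T. F (flip u B)) = sum F (Pow T)"
  using assms
  by (intro sum.reindex_bij_witness[where i = "flip u" and j = "flip u"])
     (auto simp: flip_def split: if_splits)

text \<open>
  Assouad's lemma.  Average the loss over all hypotheses \<open>B\<close> and exchange sums: each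
  coordinate \<open>u\<close> contributes the error of deciding whether \<open>u \<in> B\<close>.  Pairing \<open>B\<close> with \<open>flip u B\<close>
  turns this into testing problems between two hypotheses, where the sum of the two errors
  is at least \<open>\<alpha>\<^sup>2 / 2\<close>.  Some hypothesis does at least as badly as the average.  Weights of mass
  at most 1 allow \<open>\<Omega>\<close> to be only part of a sample space.
\<close>

theorem assouad:
  fixes q :: "'a set \<Rightarrow> 'b \<Rightarrow> real" and guess :: "'b \<Rightarrow> 'a set"
  assumes T: "finite T"
    and nonneg: "\<And>B \<omega>. B \<subseteq> T \<Longrightarrow> \<omega> \<in> \<Omega> \<Longrightarrow> 0 \<le> q B \<omega>"
    and mass: "\<And>B. B \<subseteq> T \<Longrightarrow> sum (q B) \<Omega> \<le> 1"
    and \<alpha>: "0 \<le> \<alpha>"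
    and aff: "\<And>B u. B \<subseteq> T \<Longrightarrow> u \<in> T \<Longrightarrow> \<alpha> \<le> (\<Sum>\<omega>\<in>\<Omega>. sqrt (q B \<omega> * q (flip u B) \<omega>))"
  shows "\<exists>B\<subseteq>T. real (card T) * \<alpha>\<^sup>2 / 4
    \<le> (\<Sum>\<omega>\<in>\<Omega>. q B \<omega> * card {u \<in> T. (u \<in> guess \<omega>) \<noteq> (u \<in> B)})"
proof (rule ccontr)
  define err where "err u B = (\<Sum>\<omega>\<in>\<Omega>. q B \<omega> * of_bool ((u \<in> guess \<omega>) \<noteq> (u \<in> B)))" for u B
  define loss where "loss B = (\<Sum>\<omega>\<in>\<Omega>. q B \<omega> * card {u \<in> T. (u \<in> guess \<omega>) \<noteq> (u \<in> B)})" for B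
  have loss: "loss B = (\<Sum>u\<in>T. err u B)" for B
  proof -
    have "real (card {u \<in> T. (u \<in> guess \<omega>) \<noteq> (u \<in> B)})
        = (\<Sum>u\<in>T. of_bool ((u \<in> guess \<omega>) \<noteq> (u \<in> B)))" for \<omega>
      using T by (simp add: sum.If_cases of_bool_def Int_def)
    then show ?thesis
      unfolding loss_def err_def by (simp add: sum_distrib_left sum.swap[of _ T])
  qed
  have two_point: "\<alpha>\<^sup>2 / 2 \<le> err u B + err u (flip u B)" if B: "B \<subseteq> T" and u: "u \<in> T" for B u
  proof -
    have B': "flip u B \<subseteq> T" using B u by (auto simp: flip_def)
    have "\<alpha>\<^sup>2 \<le> (\<Sum>\<omega>\<in>\<Omega>. sqrt (q B \<omega> * q (flip u B) \<omega>))\<^sup>2"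
      using aff[OF B u] \<alpha> by (intro power_mono)
    also have "\<dots> \<le> 2 * (\<Sum>\<omega>\<in>\<Omega>. min (q B \<omega>) (q (flip u B) \<omega>))"
      using nonneg mass B B' by (intro affinity_le_sum_min) auto
    also have "(\<Sum>\<omega>\<in>\<Omega>. min (q B \<omega>) (q (flip u B) \<omega>)) \<le> err u B + err u (flip u B)"
      unfolding err_def sum.distrib[symmetric]
      using nonneg B B' by (intro sum_mono) (auto simp: mem_flip_iff)
    finally show ?thesis by simp
  qed
  assume "\<not> (\<exists>B\<subseteq>T. real (card T) * \<alpha>\<^sup>2 / 4
    \<le> (\<Sum>\<omega>\<in>\<Omega>. q B \<omega> * card {u \<in> T. (u \<in> guess \<omega>) \<noteq> (u \<in> B)}))"
  then have "(\<Sum>B\<in>Pow T. loss B) < (\<Sum>B\<in>Pow T. real (card T) * \<alpha>\<^sup>2 / 4)"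
    using T by (intro sum_strict_mono) (auto simp: not_le loss_def)
  also have "\<dots> = (\<Sum>u\<in>T. \<Sum>B\<in>Pow T. \<alpha>\<^sup>2 / 4)"
    by simp
  also have "\<dots> \<le> (\<Sum>u\<in>T. \<Sum>B\<in>Pow T. err u B)"
  proof (rule sum_mono)
    fix u assume u: "u \<in> T"
    have "(\<Sum>B\<in>Pow T. \<alpha>\<^sup>2 / 2) \<le> (\<Sum>B\<in>Pow T. err u B + err u (flip u B))"
      using two_point u by (intro sum_mono) auto
    then show "(\<Sum>B\<in>Pow T. \<alpha>\<^sup>2 / 4) \<le> (\<Sum>B\<in>Pow T. err u B)"
      using sum_Pow_flip[OF u, of "err u"] by (simp add: sum.distrib)
  qed
  also have "\<dots> = (\<Sum>B\<in>Pow T. loss B)"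
    by (simp add: loss sum.swap[of _ T])
  finally show False by simp
qed

text \<open>
  Here \<open>a\<close> and \<open>c\<close> are the probabilities of a positive observed label under the two possible
  values \<open>(1 \<plusminus> h) / 2\<close> of the regression function and propensity \<open>e\<close>.  They are at distance \<open>e h\<close>
  but have size about \<open>e\<close>, so that the information on the class is of order
  \<open>(e h)\<^sup>2 / e = e h\<^sup>2\<close>.  This is where the effective sample size \<open>n e\<close>, rather than \<open>n e\<^sup>2\<close>, comes from.
\<close>

lemma bernoulli_affinity:
  fixes h e :: real
  assumes "0 \<le> h" "h \<le> 1" "0 \<le> e" "e \<le> 1"
  defines "a \<equiv> e * (1 + h) / 2" and "c \<equiv> e * (1 - h) / 2"
  shows "1 - e * h\<^sup>2 \<le> sqrt (a * c) + sqrt ((1 - a) * (1 - c))"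
proof -
  have h2: "h\<^sup>2 \<le> 1" using assms by (simp add: power_le_one)
  have "e / 2 * (1 - h\<^sup>2) \<le> sqrt (a * c)"
  proof (rule real_le_rsqrt)
    have "a * c = (e / 2)\<^sup>2 * (1 - h\<^sup>2)"
      unfolding a_def c_def by (simp add: power2_eq_square algebra_simps)
    moreover have "(1 - h\<^sup>2)\<^sup>2 \<le> 1 - h\<^sup>2"
      using h2 by (simp add: power2_eq_square[of "1 - h\<^sup>2"] mult_left_le)
    ultimately show "(e / 2 * (1 - h\<^sup>2))\<^sup>2 \<le> a * c"
      unfolding power_mult_distrib by (simp add: mult_left_mono)
  qed
  moreover have "1 - e / 2 - e * h\<^sup>2 / 2 \<le> sqrt ((1 - a) * (1 - c))"
  proof (rule real_le_rsqrt)
    have "0 \<le> (1 - e) * e * h\<^sup>2 / 2" "0 \<le> h\<^sup>2 * e\<^sup>2 * (1 - h\<^sup>2) / 4" "0 \<le> e * (1 - e) * h\<^sup>2"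
      using assms h2 by (auto intro!: mult_nonneg_nonneg divide_nonneg_pos)
    then show "(1 - e / 2 - e * h\<^sup>2 / 2)\<^sup>2 \<le> (1 - a) * (1 - c)"
      unfolding a_def c_def by (simp add: power2_eq_square field_simps)
  qed
  ultimately show ?thesis by (simp add: field_simps)
qed

text \<open>
  A point is drawn from \<open>m\<close> and then a label with success probability \<open>w\<close>, respectively \<open>w'\<close>.  When
  these differ at \<open>u\<close> only, the loss of affinity \<open>\<delta>\<close> of the label laws at \<open>u\<close> is diluted by the
  probability of observing \<open>u\<close>.
\<close>

lemma affinity_one_coordinate:
  fixes A :: "'a set" and m :: "'a \<Rightarrow> real" and w w' :: "'a \<Rightarrow> real"
  assumes A: "finite A" "sum m A = 1" "\<And>v. v \<in> A \<Longrightarrow> 0 \<le> m v" and u: "u \<in> A"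
    and w: "\<And>v. v \<in> A \<Longrightarrow> 0 \<le> w v \<and> w v \<le> 1"
    and same: "\<And>v. v \<in> A \<Longrightarrow> v \<noteq> u \<Longrightarrow> w' v = w v"
    and at_u: "1 - \<delta> \<le> sqrt (w u * w' u) + sqrt ((1 - w u) * (1 - w' u))"
  shows "1 - m u * \<delta> \<le> (\<Sum>t\<in>A \<times> UNIV. case t of (v, s) \<Rightarrow>
    sqrt ((m v * (if s then w v else 1 - w v)) * (m v * (if s then w' v else 1 - w' v))))"
proof -
  have "1 - m u * \<delta> = (\<Sum>v\<in>A. m v - (if v = u then m u * \<delta> else 0))"
    using A u by (simp add: sum_subtractf)
  also have "\<dots> \<le> (\<Sum>v\<in>A. m v * (sqrt (w v * w' v) + sqrt ((1 - w v) * (1 - w' v))))"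
  proof (rule sum_mono)
    fix v assume v: "v \<in> A"
    show "m v - (if v = u then m u * \<delta> else 0)
        \<le> m v * (sqrt (w v * w' v) + sqrt ((1 - w v) * (1 - w' v)))"
    proof (cases "v = u")
      case True
      then show ?thesis
        using mult_left_mono[OF at_u A(3)[OF u]] by (simp add: algebra_simps)
    next
      case False
      then show ?thesis using w[OF v] same[OF v] by simp
    qed
  qed
  also have "\<dots> = (\<Sum>v\<in>A. \<Sum>s\<in>UNIV.
      sqrt ((m v * (if s then w v else 1 - w v)) * (m v * (if s then w' v else 1 - w' v))))"
  proof (intro sum.cong refl)
    fix v assume v: "v \<in> A"
    have *: "sqrt ((m v * a) * (m v * b)) = m v * sqrt (a * b)" for a b
      using A(3)[OF v] by (simp add: real_sqrt_mult)
    show "m v * (sqrt (w v * w' v) + sqrt ((1 - w v) * (1 - w' v))) = (\<Sum>s\<in>UNIV.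
      sqrt ((m v * (if s then w v else 1 - w v)) * (m v * (if s then w' v else 1 - w' v))))"
      unfolding * by (simp add: UNIV_bool algebra_simps)
  qed
  also have "\<dots> = (\<Sum>t\<in>A \<times> UNIV. case t of (v, s) \<Rightarrow>
    sqrt ((m v * (if s then w v else 1 - w v)) * (m v * (if s then w' v else 1 - w' v))))"
    by (rule sum.cartesian_product)
  finally show ?thesis .
qed

section \<open>Atoms of measures and of product measures\<close>

text \<open>
  Lower bounds on a risk need only the atoms of the sampling law.  This replaces a description
  of that law as a discrete measure by the computation of the masses of finitely many points.
\<close>

lemma integral_ge_sum_atoms:
  fixes \<phi> :: "'a \<Rightarrow> real"
  assumes "finite \<Omega>" and atoms: "\<And>\<omega>. \<omega> \<in> \<Omega> \<Longrightarrow> {\<omega>} \<in> sets M"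
    and "finite_measure M" and "integrable M \<phi>" and "\<And>\<omega>. \<omega> \<in> space M \<Longrightarrow> 0 \<le> \<phi> \<omega>"
  shows "(\<Sum>\<omega>\<in>\<Omega>. measure M {\<omega>} * \<phi> \<omega>) \<le> (\<integral>\<omega>. \<phi> \<omega> \<partial>M)"
proof -
  interpret finite_measure M by fact
  have int: "integrable M (\<lambda>x. \<phi> \<omega> * indicator {\<omega>} x)" if "\<omega> \<in> \<Omega>" for \<omega>
    using atoms[OF that] by (intro integrable_mult_right integrable_real_indicator) (auto simp: less_top[symmetric])
  have "(\<Sum>\<omega>\<in>\<Omega>. measure M {\<omega>} * \<phi> \<omega>) = (\<Sum>\<omega>\<in>\<Omega>. \<integral>x. \<phi> \<omega> * indicator {\<omega>} x \<partial>M)"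
    using sets.sets_into_space[OF atoms] by (intro sum.cong refl) (auto simp: Int_absorb1)
  also have "\<dots> = (\<integral>x. (\<Sum>\<omega>\<in>\<Omega>. \<phi> \<omega> * indicator {\<omega>} x) \<partial>M)"
    using int by (intro Bochner_Integration.integral_sum[symmetric])
  also have "\<dots> \<le> (\<integral>\<omega>. \<phi> \<omega> \<partial>M)"
  proof (rule integral_mono)
    fix x assume "x \<in> space M"
    have "(\<Sum>\<omega>\<in>\<Omega>. \<phi> \<omega> * indicator {\<omega>} x) = (\<Sum>\<omega>\<in>\<Omega>. if \<omega> = x then \<phi> x else 0)"
      by (intro sum.cong) auto
    then show "(\<Sum>\<omega>\<in>\<Omega>. \<phi> \<omega> * indicator {\<omega>} x) \<le> \<phi> x"
      using assms(1,5) \<open>x \<in> space M\<close> by simp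
  qed (use int assms(4) in auto)
  finally show ?thesis .
qed

lemma measure_PiM_singleton:
  fixes n :: nat
  assumes "prob_space M" and "\<And>i. i < n \<Longrightarrow> {\<omega> i} \<in> sets M" and "\<omega> \<in> extensional {..<n}"
  shows "{\<omega>} \<in> sets (Pi\<^sub>M {..<n} (\<lambda>_. M))"
    and "measure (Pi\<^sub>M {..<n} (\<lambda>_. M)) {\<omega>} = (\<Prod>i<n. measure M {\<omega> i})"
proof -
  interpret prob_space M by fact
  interpret finite_product_prob_space "\<lambda>_. M" "{..<n}"
    by unfold_locales auto
  have eq: "{\<omega>} = (\<Pi>\<^sub>E i\<in>{..<n}. {\<omega> i})"
    using assms(3) by (simp add: PiE_singleton)
  show "{\<omega>} \<in> sets (Pi\<^sub>M {..<n} (\<lambda>_. M))"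
    unfolding eq using assms(2) by (intro sets_PiM_I_finite) auto
  show "measure (Pi\<^sub>M {..<n} (\<lambda>_. M)) {\<omega>} = (\<Prod>i<n. measure M {\<omega> i})"
    unfolding eq using assms(2) by (intro prob_times) auto
qed

text \<open>
  The point \<open>z\<close> absorbs the mass that \<open>T\<close> does not use.
\<close>

lemma exists_pmf_with_atoms:
  assumes T: "finite T" and z: "z \<notin> T" and p: "0 \<le> p" "real (card T) * p \<le> 1"
  obtains \<mu> :: "'a pmf" where "set_pmf \<mu> \<subseteq> insert z T" and "\<And>u. u \<in> T \<Longrightarrow> pmf \<mu> u = p"
proof -
  define f where "f u = (if u \<in> T then p else if u = z then 1 - card T * p else 0)" for u
  have f_nonneg: "0 \<le> f u" for u
    using p by (simp add: f_def)
  have "(\<integral>\<^sup>+u. ennreal (f u) \<partial>count_space UNIV) = (\<Sum>u\<in>insert z T. ennreal (f u))"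
    using T by (intro nn_integral_count_space') (auto simp: f_def)
  also have "\<dots> = ennreal (\<Sum>u\<in>insert z T. f u)"
    using f_nonneg by (intro sum_ennreal) auto
  also have "(\<Sum>u\<in>insert z T. f u) = 1"
  proof -
    have "sum f T = card T * p" by (simp add: f_def)
    then show ?thesis using T z by (simp add: f_def)
  qed
  finally have total: "(\<integral>\<^sup>+u. ennreal (f u) \<partial>count_space UNIV) = 1" by simp
  show thesis
  proof
    show "set_pmf (embed_pmf f) \<subseteq> insert z T"
      using set_embed_pmf[of f] f_nonneg total by (auto simp: f_def split: if_splits)
    show "pmf (embed_pmf f) u = p" if "u \<in> T" for u
      using pmf_embed_pmf[of f] f_nonneg total that by (auto simp: f_def)
  qed
qed

section \<open>The sample space\<close>

lemma singleton_in_sets_Rd: "u \<in> space (Rd d) \<Longrightarrow> {u} \<in> sets (Rd d)"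
  unfolding Rd_def
  by (subst PiE_singleton[symmetric, of u "{..<d}"])
     (auto simp: space_PiM PiE_def intro!: sets_PiM_I_finite)

lemma space_labelled: "space (labelled d) = space (Rd d) \<times> UNIV"
  by (simp add: labelled_def space_pair_measure)

lemma singleton_in_sets_labelled:
  assumes "u \<in> space (Rd d)"
  shows "{(u, y)} \<in> sets (labelled d)"
proof -
  have "{u} \<times> {y} \<in> sets (labelled d)"
    unfolding labelled_def using singleton_in_sets_Rd[OF assms] by (intro pair_measureI) auto
  then show ?thesis by simp
qed

lemma distributionsD:
  assumes "P \<in> distributions d"
  shows "prob_space P" "sets P = sets (labelled d)" "space P = space (labelled d)"
  using assms by (auto simp: distributions_def dest: sets_eq_imp_space_eq)

lemma Rd_restrict_in_space: "restrict u {..<d} \<in> space (Rd d)"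
  by (simp add: Rd_def space_PiM PiE_def)

lemma restrict_Rd_eq: "u \<in> space (Rd d) \<Longrightarrow> restrict u {..<d} = u"
  by (auto simp: Rd_def space_PiM PiE_def extensional_restrict)

lemma shattered_labellings:
  assumes "shattered d G v x"
  shows "\<exists>g\<in>G. \<forall>i<v. g (x i) = b i"
proof -
  let ?R = "(\<lambda>g. \<lambda>i\<in>{..<v}. g (x i)) ` G"
  have "?R \<subseteq> ({..<v} \<rightarrow>\<^sub>E (UNIV :: bool set))"
    by auto
  moreover have "card ?R = card ({..<v} \<rightarrow>\<^sub>E (UNIV :: bool set))"
    using assms by (simp add: shattered_def card_PiE)
  ultimately have "?R = ({..<v} \<rightarrow>\<^sub>E UNIV)"
    by (intro card_subset_eq finite_PiE) auto
  moreover have "restrict b {..<v} \<in> ({..<v} \<rightarrow>\<^sub>E (UNIV :: bool set))"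
    by auto
  ultimately have "restrict b {..<v} \<in> ?R"
    by simp
  then obtain g where g: "g \<in> G" "restrict b {..<v} = (\<lambda>i\<in>{..<v}. g (x i))"
    by auto
  have "g (x i) = b i" if "i < v" for i
    using fun_cong[OF g(2), of i] that by simp
  then show ?thesis using g(1) by auto
qed

text \<open>
  All \<open>2 ^ v\<close> label vectors are realized, in particular those that separate two given indices; so
  the points are distinct, and labellings become subsets of the set of points.
\<close>

lemma shattered_set:
  assumes x: "shattered d G v x"
  shows "card (x ` {..<v}) = v" and "\<exists>g\<in>G. \<forall>u\<in>x ` {..<v}. g u \<longleftrightarrow> u \<in> B"
proof -
  have "inj_on x {..<v}"
  proof (rule inj_onI, rule ccontr)
    fix i j assume ij: "i \<in> {..<v}" "j \<in> {..<v}" "x i = x j" "i \<noteq> j"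
    show False
      using shattered_labellings[OF x, of "\<lambda>k. k = i"] ij by (metis lessThan_iff)
  qed
  then show "card (x ` {..<v}) = v" by (simp add: card_image)
  show "\<exists>g\<in>G. \<forall>u\<in>x ` {..<v}. g u \<longleftrightarrow> u \<in> B"
    using shattered_labellings[OF x, of "\<lambda>i. x i \<in> B"] by auto
qed

section \<open>The law of a positive-unlabeled observation\<close>

lemma sets_pu_law: "sets (pu_law d e P) = sets (labelled d)"
  by (simp add: pu_law_def)

context
  fixes d :: nat and e :: "point \<Rightarrow> real" and P :: "(point \<times> bool) measure"
  assumes P: "P \<in> distributions d" and e_meas: "e \<in> borel_measurable (Rd d)"
    and e_range: "\<And>x. x \<in> space (Rd d) \<Longrightarrow> 0 \<le> e x \<and> e x \<le> 1"
begin

lemma sets_P_pair: "sets (P \<Otimes>\<^sub>M count_space (UNIV :: bool set))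
    = sets (labelled d \<Otimes>\<^sub>M count_space UNIV)"
  using distributionsD(2)[OF P] by (intro sets_pair_measure_cong) simp_all

lemma label_density_measurable:
  "(\<lambda>((x, y), s). ennreal (pmf (bernoulli_pmf (if y then e x else 0)) s))
    \<in> borel_measurable (P \<Otimes>\<^sub>M count_space UNIV)"
proof -
  note [measurable] = e_meas
  have "(\<lambda>((x, y), s). ennreal (if s then (if y then e x else 0) else 1 - (if y then e x else 0)))
    \<in> borel_measurable (labelled d \<Otimes>\<^sub>M count_space UNIV)"
    unfolding labelled_def split_beta' by measurable
  also have "?this \<longleftrightarrow> (\<lambda>((x, y), s). ennreal (pmf (bernoulli_pmf (if y then e x else 0)) s))
    \<in> borel_measurable (labelled d \<Otimes>\<^sub>M count_space UNIV)"
    using e_range by (intro measurable_cong) (auto simp: space_pair_measure space_labelled)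
  also have "\<dots> \<longleftrightarrow> ?thesis"
    using measurable_cong_sets[OF sets_P_pair refl] by auto
  finally show ?thesis .
qed

lemma prob_space_pu_joint_law: "prob_space (pu_joint_law e P)"
proof
  let ?f = "\<lambda>((x, y), s). ennreal (pmf (bernoulli_pmf (if y then e x else 0)) s)"
  interpret P: prob_space P using distributionsD[OF P] by simp
  interpret C: sigma_finite_measure "count_space (UNIV :: bool set)"
    by (rule sigma_finite_measure_count_space_finite) simp
  have "emeasure (pu_joint_law e P) (space (pu_joint_law e P))
      = (\<integral>\<^sup>+t. ?f t \<partial>(P \<Otimes>\<^sub>M count_space UNIV))"
    unfolding pu_joint_law_def using label_density_measurable
    by (subst emeasure_density) (auto intro!: nn_integral_cong)
  also have "\<dots> = (\<integral>\<^sup>+t. \<integral>\<^sup>+s. ?f (t, s) \<partial>count_space UNIV \<partial>P)"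
    using label_density_measurable by (rule C.nn_integral_fst[symmetric])
  also have "\<dots> = (\<integral>\<^sup>+t. 1 \<partial>P)"
    by (intro nn_integral_cong) (auto simp: nn_integral_pmf_eq_1)
  finally show "emeasure (pu_joint_law e P) (space (pu_joint_law e P)) = 1"
    using P.emeasure_space_1 by simp
qed

lemma forget_class_measurable:
  "(\<lambda>((x, y), s). (x, s)) \<in> measurable (pu_joint_law e P) (labelled d)"
proof -
  have "(\<lambda>((x, y), s). (x, s)) \<in> measurable (labelled d \<Otimes>\<^sub>M count_space UNIV) (labelled d)"
    unfolding labelled_def split_beta' by measurable
  also have "measurable (labelled d \<Otimes>\<^sub>M count_space UNIV) (labelled d)
      = measurable (pu_joint_law e P) (labelled d)"
    unfolding pu_joint_law_def 
    by (intro measurable_cong_sets) (simp_all add: sets_P_pair)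
  finally show ?thesis .
qed

lemma prob_space_pu_law: "prob_space (pu_law d e P)"
  unfolding pu_law_def
  using prob_space_pu_joint_law forget_class_measurable by (rule prob_space.prob_space_distr)

text \<open>
  A positive observed label comes from a positive class that was revealed; a negative one comes
  from a positive class that was not, or from a negative class.
\<close>

lemma measure_pu_law_singleton:
  assumes u: "u \<in> space (Rd d)"
  shows "measure (pu_law d e P) {(u, s)} =
    measure P {(u, True)} * (if s then e u else 1 - e u) +
    measure P {(u, False)} * (if s then 0 else 1)"
proof -
  interpret P: prob_space P using distributionsD[OF P] by simp
  interpret C: sigma_finite_measure "count_space (UNIV :: bool set)"
    by (rule sigma_finite_measure_count_space_finite) simp
  let ?A = "{((u, True), s), ((u, False), s)}"
  let ?f = "\<lambda>((x, y), s). ennreal (pmf (bernoulli_pmf (if y then e x else 0)) s)"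
  have P_sets: "{(u, y)} \<in> sets P" for y
    using singleton_in_sets_labelled[OF u] distributionsD(2)[OF P] by simp
  have atom: "{((u, y), s)} \<in> sets (P \<Otimes>\<^sub>M count_space UNIV)"
    "emeasure (P \<Otimes>\<^sub>M count_space UNIV) {((u, y), s)} = ennreal (measure P {(u, y)})" for y
  proof -
    have eq: "{((u, y), s)} = {(u, y)} \<times> {s}" by simp
    show "{((u, y), s)} \<in> sets (P \<Otimes>\<^sub>M count_space UNIV)"
      unfolding eq using P_sets by (intro pair_measureI) auto
    show "emeasure (P \<Otimes>\<^sub>M count_space UNIV) {((u, y), s)} = ennreal (measure P {(u, y)})"
      unfolding eq using P_sets
      by (subst C.emeasure_pair_measure_Times) (auto simp: P.emeasure_eq_measure)
  qed
  have A_sets: "?A \<in> sets (P \<Otimes>\<^sub>M count_space UNIV)"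
    using sets.Un[OF atom(1)[of True] atom(1)[of False]] by (simp add: insert_commute)
  have "emeasure (pu_law d e P) {(u, s)} =
      emeasure (pu_joint_law e P) ((\<lambda>((x, y), s). (x, s)) -` {(u, s)} \<inter> space (pu_joint_law e P))"
    unfolding pu_law_def using forget_class_measurable singleton_in_sets_labelled[OF u]
    by (rule emeasure_distr)
  also have "(\<lambda>((x, y), s). (x, s)) -` {(u, s)} \<inter> space (pu_joint_law e P) = ?A"
    using u distributionsD(3)[OF P]
    by (auto simp: pu_joint_law_def space_pair_measure space_labelled)
  also have "emeasure (pu_joint_law e P) ?A = (\<integral>\<^sup>+t. ?f t * indicator ?A t \<partial>(P \<Otimes>\<^sub>M count_space UNIV))"
    unfolding pu_joint_law_def using label_density_measurable A_sets by (rule emeasure_density)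
  also have "\<dots> = (\<Sum>t\<in>?A. ?f t * emeasure (P \<Otimes>\<^sub>M count_space UNIV) {t})"
    using atom(1) by (intro nn_integral_indicator_finite) auto
  also have "\<dots> = ?f ((u, True), s) * ennreal (measure P {(u, True)})
      + ?f ((u, False), s) * ennreal (measure P {(u, False)})"
    by (simp add: atom)
  also have "\<dots> = ennreal (measure P {(u, True)} * (if s then e u else 1 - e u) +
    measure P {(u, False)} * (if s then 0 else 1))"
    using e_range[OF u] 
    by (cases s) (simp_all add: ennreal_mult[symmetric] ennreal_plus[symmetric] mult.commute del: ennreal_plus)
  finally show ?thesis
    using e_range[OF u] by (simp add: measure_def enn2real_ennreal del: ennreal_plus)
qed

end

section \<open>Distributions with finitely many atoms\<close>

text \<open>
  The law of \<open>(X, Y)\<close> when \<open>X\<close> has the discrete law \<open>\<mu>\<close> and \<open>Y\<close> is, given \<open>X = u\<close>, Bernoulli with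
  parameter \<open>\<eta> u\<close>.  A probability mass function lives on all functions of type \<open>point\<close>; restricting
  them to \<open>{..<d}\<close> maps into the space of dimension \<open>d\<close> and changes none of its points.
\<close>

definition atomic_law :: "nat \<Rightarrow> point pmf \<Rightarrow> (point \<Rightarrow> real) \<Rightarrow> (point \<times> bool) measure" where
  "atomic_law d \<mu> \<eta> =
     distr (measure_pmf (\<mu> \<bind> (\<lambda>u. map_pmf (Pair u) (bernoulli_pmf (\<eta> u))))) (labelled d)
       (\<lambda>(u, y). (restrict u {..<d}, y))"

locale atomic_model =
  fixes d :: nat and \<mu> :: "point pmf" and \<eta> :: "point \<Rightarrow> real"
  assumes finite_support: "finite (set_pmf \<mu>)"
    and support: "set_pmf \<mu> \<subseteq> space (Rd d)"
    and \<eta>_meas: "\<eta> \<in> borel_measurable (Rd d)"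
    and \<eta>_range: "\<And>u. u \<in> space (Rd d) \<Longrightarrow> 0 \<le> \<eta> u \<and> \<eta> u \<le> 1"
begin

abbreviation law :: "(point \<times> bool) measure" where
  "law \<equiv> atomic_law d \<mu> \<eta>"

lemma embedding_measurable:
  "(\<lambda>(u, y). (restrict u {..<d}, y)) \<in> measurable (measure_pmf M) (labelled d)"
  by (auto simp: space_labelled Rd_restrict_in_space)

lemma law_in_distributions: "law \<in> distributions d"
  unfolding distributions_def atomic_law_def
  using measure_pmf.prob_space_distr[OF embedding_measurable] by simp

lemma integral_law:
  fixes F :: "point \<times> bool \<Rightarrow> real"
  assumes "F \<in> borel_measurable (labelled d)"
  shows "(\<integral>t. F t \<partial>law) = (\<integral>u. \<eta> u * F (u, True) + (1 - \<eta> u) * F (u, False) \<partial>\<mu>)"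
proof -
  let ?\<iota> = "\<lambda>(u, y). (restrict u {..<d}, y :: bool)"
  have "(\<integral>t. F t \<partial>law) = measure_pmf.expectation (\<mu> \<bind> (\<lambda>u. map_pmf (Pair u) (bernoulli_pmf (\<eta> u)))) (\<lambda>t. F (?\<iota> t))"
    unfolding atomic_law_def using embedding_measurable assms by (rule integral_distr)
  also have "\<dots> = (\<Sum>u\<in>set_pmf \<mu>. pmf \<mu> u *\<^sub>R
      measure_pmf.expectation (map_pmf (Pair u) (bernoulli_pmf (\<eta> u))) (\<lambda>t. F (?\<iota> t)))"
    using finite_support by (intro pmf_expectation_bind) auto
  also have "\<dots> = (\<Sum>u\<in>set_pmf \<mu>. pmf \<mu> u *\<^sub>R (\<eta> u * F (u, True) + (1 - \<eta> u) * F (u, False)))"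
    using \<eta>_range support by (intro sum.cong refl) (auto simp: restrict_Rd_eq subset_iff mult.commute)
  also have "\<dots> = (\<integral>u. \<eta> u * F (u, True) + (1 - \<eta> u) * F (u, False) \<partial>\<mu>)"
    using finite_support by (intro integral_measure_pmf[symmetric]) auto
  finally show ?thesis .
qed

lemma measure_law:
  assumes "A \<in> sets (labelled d)"
  shows "measure law A = (\<integral>u. \<eta> u * indicator A (u, True) + (1 - \<eta> u) * indicator A (u, False) \<partial>\<mu>)"
proof -
  have "A \<subseteq> space law"
    using assms sets.sets_into_space distributionsD(3)[OF law_in_distributions] by blast
  then have "measure law A = (\<integral>t. indicator A t \<partial>law)"
    by (simp add: Int_absorb2)
  also have "\<dots> = (\<integral>u. \<eta> u * indicator A (u, True) + (1 - \<eta> u) * indicator A (u, False) \<partial>\<mu>)"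
    using assms by (intro integral_law) auto
  finally show ?thesis .
qed

lemma measure_law_singleton:
  assumes "u \<in> space (Rd d)"
  shows "measure law {(u, y)} = pmf \<mu> u * (if y then \<eta> u else 1 - \<eta> u)"
  unfolding measure_law[OF singleton_in_sets_labelled[OF assms]]
  by (subst integral_measure_pmf_real[of "{u}"]) (auto simp: indicator_def of_bool_def split: if_splits)

lemma regression_version_law: "regression_version d law \<eta>"
  unfolding regression_version_def
proof (intro conjI ballI)
  fix A assume A: "A \<in> sets (Rd d)"
  note [measurable] = A \<eta>_meas
  have "measure law (A \<times> {True}) = (\<integral>u. \<eta> u * indicator A u \<partial>\<mu>)"
  proof (subst measure_law)
    show "A \<times> {True} \<in> sets (labelled d)"
      unfolding labelled_def using A by (intro pair_measureI) auto
  qed (simp add: indicator_times)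
  also have "\<dots> = (\<integral>u. \<eta> u * (indicator A u * \<eta> u) + (1 - \<eta> u) * (indicator A u * \<eta> u) \<partial>\<mu>)"
    by (intro Bochner_Integration.integral_cong) (auto simp: algebra_simps)
  also have "\<dots> = (\<integral>(x, y). indicator A x * \<eta> x \<partial>law)"
    by (subst integral_law) (auto simp: labelled_def split_beta')
  finally show "measure law (A \<times> {True}) = (\<integral>(x, y). indicator A x * \<eta> x \<partial>law)" .
qed (use \<eta>_meas \<eta>_range in auto)

text \<open>
  A version of the regression function is determined on the atoms.  Hence the version that is
  selected in the excess risk does not matter, although it is unknown elsewhere.
\<close>

lemma regression_version_law_eq:
  assumes ver: "regression_version d law \<eta>'" and u: "u \<in> set_pmf \<mu>"
  shows "\<eta>' u = \<eta> u"
proof -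
  have u_Rd: "u \<in> space (Rd d)" using u support by auto
  note [measurable] = singleton_in_sets_Rd[OF u_Rd]
  have [measurable]: "\<eta>' \<in> borel_measurable (Rd d)"
    using ver by (simp add: regression_version_def)
  have "pmf \<mu> u * \<eta> u = measure law ({u} \<times> {True})"
    using measure_law_singleton[OF u_Rd, of True] by simp
  also have "\<dots> = (\<integral>(x, y). indicator {u} x * \<eta>' x \<partial>law)"
    using ver singleton_in_sets_Rd[OF u_Rd] unfolding regression_version_def by blast
  also have "\<dots> = (\<integral>v. \<eta> v * (indicator {u} v * \<eta>' v) + (1 - \<eta> v) * (indicator {u} v * \<eta>' v) \<partial>\<mu>)"
    by (subst integral_law) (auto simp: labelled_def split_beta')
  also have "\<dots> = pmf \<mu> u * \<eta>' u"
    by (subst integral_measure_pmf_real[of "{u}"]) (auto simp: indicator_def algebra_simps)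
  finally show ?thesis using u by (simp add: set_pmf_iff)
qed

lemma risk_law:
  assumes g: "g \<in> measurable (Rd d) (count_space UNIV)"
  shows "risk law g = (\<integral>u. (if g u then 1 - \<eta> u else \<eta> u) \<partial>\<mu>)"
proof -
  let ?A = "{(x, y) \<in> space (labelled d). g x \<noteq> y}"
  note [measurable] = g
  have "{t \<in> space (Rd d \<Otimes>\<^sub>M count_space UNIV). g (fst t) \<noteq> snd t} \<in> sets (Rd d \<Otimes>\<^sub>M count_space UNIV)"
    by measurable
  then have A: "?A \<in> sets (labelled d)"
    by (simp add: labelled_def split_beta')
  have "risk law g = measure law ?A"
    by (simp add: risk_def distributionsD(3)[OF law_in_distributions])
  also have "\<dots> = (\<integral>u. (if g u then 1 - \<eta> u else \<eta> u) \<partial>\<mu>)"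
    unfolding measure_law[OF A] using support
    by (intro integral_cong_AE) (auto simp: AE_measure_pmf_iff space_labelled indicator_def)
  finally show ?thesis .
qed

lemma bayes_measurable:
  assumes "regression_version d P \<eta>'"
  shows "bayes d \<eta>' \<in> measurable (Rd d) (count_space UNIV)"
proof -
  have [measurable]: "\<eta>' \<in> borel_measurable (Rd d)"
    using assms by (simp add: regression_version_def)
  have "(\<lambda>x. 1 / 2 \<le> \<eta>' x) \<in> measurable (Rd d) (count_space UNIV)"
    by measurable
  then show ?thesis
    unfolding bayes_def by (subst measurable_cong[where g = "\<lambda>x. 1 / 2 \<le> \<eta>' x"]) auto
qed

text \<open>
  The usual formula for the excess risk: a disagreement with the Bayes classifier at \<open>u\<close> costs
  \<open>1 - \<eta> u\<close> instead of \<open>\<eta> u\<close> or conversely, hence \<open>\<bar>2 \<eta> u - 1\<bar>\<close> more.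
\<close>

lemma excess_risk_law:
  assumes g: "g \<in> measurable (Rd d) (count_space UNIV)"
  shows "excess_risk d law g = (\<integral>u. \<bar>2 * \<eta> u - 1\<bar> * of_bool (g u \<noteq> (1 / 2 \<le> \<eta> u)) \<partial>\<mu>)"
proof -
  define \<eta>' where "\<eta>' = (SOME \<eta>. regression_version d law \<eta>)"
  have ver: "regression_version d law \<eta>'"
    unfolding \<eta>'_def using regression_version_law by (rule someI[of "regression_version d law"])
  have "excess_risk d law g = risk law g - risk law (bayes d \<eta>')"
    by (simp add: excess_risk_def \<eta>'_def)
  also have "\<dots> = (\<integral>u. (if g u then 1 - \<eta> u else \<eta> u)
      - (if bayes d \<eta>' u then 1 - \<eta> u else \<eta> u) \<partial>\<mu>)"
    unfolding risk_law[OF g] risk_law[OF bayes_measurable[OF ver]]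
    using finite_support
    by (intro Bochner_Integration.integral_diff[symmetric] integrable_measure_pmf_finite)
  also have "\<dots> = (\<integral>u. \<bar>2 * \<eta> u - 1\<bar> * of_bool (g u \<noteq> (1 / 2 \<le> \<eta> u)) \<partial>\<mu>)"
  proof (intro integral_cong_AE)
    show "AE u in \<mu>. (if g u then 1 - \<eta> u else \<eta> u) - (if bayes d \<eta>' u then 1 - \<eta> u else \<eta> u)
        = \<bar>2 * \<eta> u - 1\<bar> * of_bool (g u \<noteq> (1 / 2 \<le> \<eta> u))"
      unfolding AE_measure_pmf_iff
    proof
      fix u assume u: "u \<in> set_pmf \<mu>"
      then have "bayes d \<eta>' u \<longleftrightarrow> 1 / 2 \<le> \<eta> u"
        using support regression_version_law_eq[OF ver u] by (auto simp: bayes_def)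
      then show "(if g u then 1 - \<eta> u else \<eta> u) - (if bayes d \<eta>' u then 1 - \<eta> u else \<eta> u)
        = \<bar>2 * \<eta> u - 1\<bar> * of_bool (g u \<noteq> (1 / 2 \<le> \<eta> u))"
        by auto
    qed
  qed auto
  finally show ?thesis .
qed

lemma measure_pu_law_atom:
  assumes "e \<in> borel_measurable (Rd d)" and "\<And>x. x \<in> space (Rd d) \<Longrightarrow> 0 \<le> e x \<and> e x \<le> 1"
    and "u \<in> space (Rd d)"
  shows "measure (pu_law d e law) {(u, s)} = pmf \<mu> u * (if s then \<eta> u * e u else 1 - \<eta> u * e u)"
proof -
  have "measure (pu_law d e law) {(u, s)} = measure law {(u, True)} * (if s then e u else 1 - e u)
      + measure law {(u, False)} * (if s then 0 else 1)"
    using law_in_distributions assms by (rule measure_pu_law_singleton)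
  then show ?thesis
    by (cases s) (simp_all add: measure_law_singleton[OF assms(3)] algebra_simps)
qed

end

section \<open>Risk lower bound from a shattered set\<close>

lemma classifiers_measurable:
  "G \<subseteq> classifiers d \<Longrightarrow> g \<in> G \<Longrightarrow> g \<in> measurable (Rd d) (count_space UNIV)"
  by (auto simp: classifiers_def)

text \<open>
  The class contains a classifier \<open>\<gamma> B\<close> for each \<open>B \<subseteq> T\<close>, and \<open>\<eta> B = (1 \<plusminus> h) / 2\<close> according to \<open>\<gamma> B\<close> is a
  regression function with margin exactly \<open>h\<close> on the whole space and Bayes classifier \<open>\<gamma> B\<close>.  The laws of
  \<open>X\<close> agree, with mass \<open>p\<close> at each point of \<open>T\<close>.  The laws of the sample for \<open>B\<close> and \<open>flip u B\<close> differ
  only through the labels at \<open>u\<close>, so the affinity of the samples is at least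
  \<open>(1 - p E h\<^sup>2) ^ n \<ge> 1 / 2\<close>.  Each point of \<open>T\<close> that is misclassified costs \<open>p h\<close>, and Assouad's lemma
  provides a hypothesis with at least \<open>card T / 16\<close> of them on average.
\<close>

theorem minimax_risk_lower_bound:
  assumes G: "G \<subseteq> classifiers d"
    and T: "finite T" and z: "z \<notin> T" and T_Rd: "insert z T \<subseteq> space (Rd d)"
    and realized: "\<And>B. B \<subseteq> T \<Longrightarrow> \<exists>g\<in>G. \<forall>u\<in>insert z T. g u \<longleftrightarrow> u \<in> B"
    and h: "0 < h" "h \<le> 1"
    and e_meas: "e \<in> borel_measurable (Rd d)"
    and e_range: "\<And>x. x \<in> space (Rd d) \<Longrightarrow> 0 \<le> e x \<and> e x \<le> 1"
    and e_le: "\<And>u. u \<in> T \<Longrightarrow> e u \<le> E"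
    and p: "0 \<le> p" "real (card T) * p \<le> 1"
    and n: "real n * (p * E * h\<^sup>2) \<le> 1 / 2"
  shows "ereal (real (card T) * p * h / 16) \<le> minimax_risk d n e G h"
proof -
  obtain \<mu> where \<mu>: "set_pmf \<mu> \<subseteq> insert z T" "\<And>u. u \<in> T \<Longrightarrow> pmf \<mu> u = p"
    using exists_pmf_with_atoms[OF T z p] by blast
  have "\<exists>\<gamma>. \<forall>B\<in>Pow T. \<gamma> B \<in> G \<and> (\<forall>u\<in>insert z T. \<gamma> B u \<longleftrightarrow> u \<in> B)"
    using realized by (intro bchoice) blast
  then obtain \<gamma> where \<gamma>_G: "\<And>B. B \<subseteq> T \<Longrightarrow> \<gamma> B \<in> G"
    and \<gamma>: "\<And>B u. B \<subseteq> T \<Longrightarrow> u \<in> insert z T \<Longrightarrow> \<gamma> B u \<longleftrightarrow> u \<in> B"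
    by blast
  define \<eta> where "\<eta> B u = (if \<gamma> B u then (1 + h) / 2 else (1 - h) / 2)" for B u
  define P where "P B = atomic_law d \<mu> (\<eta> B)" for B
  have bayes_iff: "1 / 2 \<le> \<eta> B u \<longleftrightarrow> \<gamma> B u" for B u
    using h by (simp add: \<eta>_def)
  have margin: "\<bar>2 * \<eta> B u - 1\<bar> = h" for B u
    using h by (simp add: \<eta>_def field_simps)
  have model: "atomic_model d \<mu> (\<eta> B)" if B: "B \<subseteq> T" for B
  proof
    show "finite (set_pmf \<mu>)" using \<mu>(1) T by (auto intro: finite_subset)
    show "set_pmf \<mu> \<subseteq> space (Rd d)" using \<mu>(1) T_Rd by blast
    have [measurable]: "\<gamma> B \<in> measurable (Rd d) (count_space UNIV)"
      using classifiers_measurable[OF G \<gamma>_G[OF B]] .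
    show "\<eta> B \<in> borel_measurable (Rd d)" unfolding \<eta>_def by measurable
  qed (use h in \<open>auto simp: \<eta>_def\<close>)
  have P_distr: "P B \<in> distributions d" if "B \<subseteq> T" for B
    unfolding P_def using model[OF that] by (rule atomic_model.law_in_distributions)
  have P_margin: "P B \<in> margin_class d G h" if B: "B \<subseteq> T" for B
  proof -
    have "\<gamma> B \<in> extensional (space (Rd d))"
      using \<gamma>_G[OF B] G by (auto simp: classifiers_def)
    then have "bayes d (\<eta> B) = \<gamma> B"
      unfolding bayes_def bayes_iff by (rule extensional_restrict)
    then show ?thesis
      unfolding margin_class_def
      using P_distr[OF B] \<gamma>_G[OF B] margin atomic_model.regression_version_law[OF model[OF B]]
      by (auto simp: P_def intro!: exI[of _ "\<eta> B"])
  qed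
  define M where "M B = Pi\<^sub>M {..<n} (\<lambda>_. pu_law d e (P B))" for B
  define A where "A = insert z T \<times> (UNIV :: bool set)"
  define \<Omega> where "\<Omega> = {..<n} \<rightarrow>\<^sub>E A"
  define r where "r B t = measure (pu_law d e (P B)) {t}" for B t
  define q where "q B \<omega> = (\<Prod>i<n. r B (\<omega> i))" for B \<omega>
  have A_fin: "finite A" and \<Omega>_fin: "finite \<Omega>"
    using T by (auto simp: A_def \<Omega>_def intro!: finite_PiE)
  have pu_prob: "prob_space (pu_law d e (P B))" if "B \<subseteq> T" for B
    using P_distr[OF that] e_meas e_range by (rule prob_space_pu_law)
  have atoms: "{\<omega>} \<in> sets (M B)" "measure (M B) {\<omega>} = q B \<omega>" if "B \<subseteq> T" "\<omega> \<in> \<Omega>" for B \<omega>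
  proof -
    have "{\<omega> i} \<in> sets (pu_law d e (P B))" if "i < n" for i
    proof -
      have "\<omega> i \<in> A" using that \<open>\<omega> \<in> \<Omega>\<close> by (auto simp: \<Omega>_def)
      then show ?thesis
        using T_Rd singleton_in_sets_labelled by (cases "\<omega> i") (auto simp: sets_pu_law A_def)
    qed
    moreover have "\<omega> \<in> extensional {..<n}" using that by (auto simp: \<Omega>_def PiE_def)
    ultimately show "{\<omega>} \<in> sets (M B)" "measure (M B) {\<omega>} = q B \<omega>"
      unfolding M_def q_def r_def using pu_prob[OF \<open>B \<subseteq> T\<close>]
      by (intro measure_PiM_singleton; simp)+
  qed
  have r_eq: "r B (u, s) = pmf \<mu> u * (if s then \<eta> B u * e u else 1 - \<eta> B u * e u)"
    if "B \<subseteq> T" "u \<in> insert z T" for B u s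
    unfolding r_def P_def using that T_Rd e_meas e_range
    by (intro atomic_model.measure_pu_law_atom model) auto
  have \<mu>_total: "(\<Sum>u\<in>insert z T. pmf \<mu> u) = 1"
    using \<mu>(1) T by (intro sum_pmf_eq_1) auto
  have r_total: "(\<Sum>t\<in>A. r B t) = 1" if B: "B \<subseteq> T" for B
  proof -
    have "(\<Sum>t\<in>A. r B t) = (\<Sum>u\<in>insert z T. \<Sum>s\<in>UNIV. r B (u, s))"
      unfolding A_def by (simp add: sum.cartesian_product)
    also have "\<dots> = (\<Sum>u\<in>insert z T. pmf \<mu> u)"
      using B by (intro sum.cong refl) (simp add: r_eq UNIV_bool algebra_simps)
    finally show ?thesis using \<mu>_total by simp
  qed
  have affinity: "1 / 2 \<le> (\<Sum>\<omega>\<in>\<Omega>. sqrt (q B \<omega> * q (flip u B) \<omega>))"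
    if B: "B \<subseteq> T" and u: "u \<in> T" for B u
  proof -
    have B': "flip u B \<subseteq> T" using B u by (auto simp: flip_def)
    have u_Rd: "u \<in> space (Rd d)" using u T_Rd by auto
    have pq: "p * (e u * h\<^sup>2) \<le> p * E * h\<^sup>2"
      using e_le[OF u] p(1) by (simp add: mult.assoc mult_left_mono mult_right_mono)
    have "1 - e u * h\<^sup>2 \<le> sqrt (e u * (1 + h) / 2 * (e u * (1 - h) / 2)) +
        sqrt ((1 - e u * (1 + h) / 2) * (1 - e u * (1 - h) / 2))"
      using h e_range[OF u_Rd] by (intro bernoulli_affinity) auto
    then have at_u: "1 - e u * h\<^sup>2 \<le> sqrt (\<eta> B u * e u * (\<eta> (flip u B) u * e u)) +
        sqrt ((1 - \<eta> B u * e u) * (1 - \<eta> (flip u B) u * e u))"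
      using \<gamma>[OF B, of u] \<gamma>[OF B', of u] u
      by (cases "u \<in> B") (simp_all add: \<eta>_def mem_flip_iff mult.commute)
    have "1 - p * E * h\<^sup>2 \<le> 1 - pmf \<mu> u * (e u * h\<^sup>2)"
      using pq \<mu>(2)[OF u] by simp
    also have "\<dots> \<le> (\<Sum>t\<in>A. case t of (v, s) \<Rightarrow>
        sqrt ((pmf \<mu> v * (if s then \<eta> B v * e v else 1 - \<eta> B v * e v)) *
          (pmf \<mu> v * (if s then \<eta> (flip u B) v * e v else 1 - \<eta> (flip u B) v * e v))))"
      unfolding A_def
    proof (rule affinity_one_coordinate)
      fix v assume v: "v \<in> insert z T"
      have "v \<in> space (Rd d)" using v T_Rd by auto
      then show "0 \<le> \<eta> B v * e v \<and> \<eta> B v * e v \<le> 1"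
        using atomic_model.\<eta>_range[OF model[OF B]] e_range by (simp add: mult_le_one)
      assume "v \<noteq> u"
      then show "\<eta> (flip u B) v * e v = \<eta> B v * e v"
        using \<gamma>[OF B v] \<gamma>[OF B' v] by (simp add: \<eta>_def mem_flip_iff)
    qed (use T \<mu>_total u at_u in auto)
    also have "\<dots> = (\<Sum>t\<in>A. sqrt (r B t * r (flip u B) t))"
      using B B' by (intro sum.cong refl) (auto simp: A_def r_eq)
    finally have one: "1 - p * E * h\<^sup>2 \<le> (\<Sum>t\<in>A. sqrt (r B t * r (flip u B) t))" .
    have E: "0 \<le> E"
      using e_range[OF u_Rd] e_le[OF u] by linarith
    have small: "p * E * h\<^sup>2 \<le> 1 / 2" if "n \<noteq> 0"
    proof -
      have "1 * (p * E * h\<^sup>2) \<le> real n * (p * E * h\<^sup>2)"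
        using that p(1) E by (intro mult_right_mono) auto
      then show ?thesis using n by simp
    qed
    \<comment> \<open>Bernoulli's inequality keeps the constant explicit; it needs \<open>p E h\<^sup>2 \<le> 1\<close>, hence \<open>small\<close>.\<close>
    have "1 / 2 \<le> 1 + real n * - (p * E * h\<^sup>2)"
      using n by simp
    also have "\<dots> \<le> (1 + - (p * E * h\<^sup>2)) ^ n"
      using small Bernoulli_inequality[of "- (p * E * h\<^sup>2)" n] by (cases "n = 0") auto
    also have "\<dots> \<le> (\<Sum>t\<in>A. sqrt (r B t * r (flip u B) t)) ^ n"
      using one small by (cases "n = 0") (auto intro!: power_mono)
    also have "\<dots> = (\<Sum>\<omega>\<in>\<Omega>. sqrt (q B \<omega> * q (flip u B) \<omega>))"
      unfolding \<Omega>_def q_def using A_fin by (rule affinity_power[symmetric])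
    finally show ?thesis .
  qed
  show ?thesis
    unfolding minimax_risk_def
  proof (rule INF_greatest)
    fix f assume f: "f \<in> estimators d n G"
    have "\<exists>B\<subseteq>T. real (card T) * (1 / 2)\<^sup>2 / 4
      \<le> (\<Sum>\<omega>\<in>\<Omega>. q B \<omega> * card {u \<in> T. (u \<in> {u. f \<omega> u}) \<noteq> (u \<in> B)})"
    proof (rule assouad[OF T])
      show "0 \<le> q B \<omega>" for B \<omega>
        unfolding q_def r_def by (intro prod_nonneg) auto
      show "sum (q B) \<Omega> \<le> 1" if "B \<subseteq> T" for B
      proof -
        have "sum (q B) \<Omega> = (\<Prod>i<n. \<Sum>t\<in>A. r B t)"
          unfolding \<Omega>_def q_def using A_fin by (intro prod_sum_PiE[symmetric]) auto
        then show ?thesis using r_total[OF that] by simp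
      qed
    qed (use affinity in auto)
    then obtain B where B: "B \<subseteq> T"
      and loss: "real (card T) / 16 \<le> (\<Sum>\<omega>\<in>\<Omega>. q B \<omega> * card {u \<in> T. f \<omega> u \<noteq> (u \<in> B)})"
      by (auto simp: power2_eq_square)
    interpret atomic_model d \<mu> "\<eta> B" by (rule model[OF B])
    interpret M: prob_space "M B"
      unfolding M_def by (intro prob_space_PiM pu_prob B)
    have M_sets: "sets (M B) = sets (Pi\<^sub>M {..<n} (\<lambda>_. labelled d))"
      unfolding M_def by (intro sets_PiM_cong) (auto simp: sets_pu_law)
    have f_meas: "f D \<in> measurable (Rd d) (count_space UNIV)" if "D \<in> space (M B)" for D
    proof -
      have "f D \<in> G"
        using f that sets_eq_imp_space_eq[OF M_sets] by (auto simp: estimators_def)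
      then show ?thesis using classifiers_measurable[OF G] by blast
    qed
    have excess: "excess_risk d (P B) g = (\<integral>u. h * of_bool (g u \<noteq> \<gamma> B u) \<partial>\<mu>)"
      if "g \<in> measurable (Rd d) (count_space UNIV)" for g
      unfolding P_def excess_risk_law[OF that] by (simp only: margin bayes_iff)
    have excess_ge: "p * h * card {u \<in> T. g u \<noteq> (u \<in> B)} \<le> excess_risk d (P B) g"
      if g: "g \<in> measurable (Rd d) (count_space UNIV)" for g
    proof -
      have "p * h * card {u \<in> T. g u \<noteq> (u \<in> B)} = (\<Sum>u\<in>T. h * of_bool (g u \<noteq> (u \<in> B)) * p)"
        using T by (simp add: sum_distrib_left[symmetric] sum_distrib_right[symmetric] of_bool_def
            sum.If_cases Int_def)
      also have "\<dots> = (\<Sum>u\<in>T. h * of_bool (g u \<noteq> \<gamma> B u) * pmf \<mu> u)"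
        using \<gamma>[OF B] \<mu>(2) by (intro sum.cong) auto
      also have "\<dots> \<le> (\<Sum>u\<in>insert z T. h * of_bool (g u \<noteq> \<gamma> B u) * pmf \<mu> u)"
        using T h by (intro sum_mono2) auto
      also have "\<dots> = excess_risk d (P B) g"
        unfolding excess[OF g] using T \<mu>(1)
        by (intro integral_measure_pmf_real[symmetric]) auto
      finally show ?thesis .
    qed
    have excess_nonneg: "0 \<le> excess_risk d (P B) (f D)" if "D \<in> space (M B)" for D
      using excess_ge[OF f_meas[OF that]] p h
      by (smt (verit) mult_nonneg_nonneg of_nat_0_le_iff)
    have "integrable (M B) (\<lambda>D. risk (P B) (f D))"
    proof (rule M.integrable_const_bound[where B = 1])
      interpret P: prob_space "P B" using distributionsD[OF P_distr[OF B]] by simp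
      show "AE D in M B. norm (risk (P B) (f D)) \<le> 1"
        by (simp add: risk_def)
      have "(\<lambda>D. risk (P B) (f D)) \<in> borel_measurable (Pi\<^sub>M {..<n} (\<lambda>_. labelled d))"
        using f P_distr[OF B] by (auto simp: estimators_def)
      then show "(\<lambda>D. risk (P B) (f D)) \<in> borel_measurable (M B)"
        using measurable_cong_sets[OF M_sets refl] by blast
    qed
    then have excess_int: "integrable (M B) (\<lambda>D. excess_risk d (P B) (f D))"
      unfolding excess_risk_def by (intro Bochner_Integration.integrable_diff) auto
    have "real (card T) * p * h / 16 = p * h * (real (card T) / 16)"
      by simp
    also have "\<dots> \<le> p * h * (\<Sum>\<omega>\<in>\<Omega>. q B \<omega> * card {u \<in> T. f \<omega> u \<noteq> (u \<in> B)})"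
      using loss p h by (intro mult_left_mono) auto
    also have "\<dots> = (\<Sum>\<omega>\<in>\<Omega>. measure (M B) {\<omega>} * (p * h * card {u \<in> T. f \<omega> u \<noteq> (u \<in> B)}))"
      unfolding sum_distrib_left using atoms(2)[OF B] by (intro sum.cong) (auto simp: mult_ac)
    also have "\<dots> \<le> (\<Sum>\<omega>\<in>\<Omega>. measure (M B) {\<omega>} * excess_risk d (P B) (f \<omega>))"
    proof (intro sum_mono mult_left_mono)
      fix \<omega> assume "\<omega> \<in> \<Omega>"
      then have "\<omega> \<in> space (M B)" using sets.sets_into_space[OF atoms(1)[OF B]] by auto
      then show "p * h * card {u \<in> T. f \<omega> u \<noteq> (u \<in> B)} \<le> excess_risk d (P B) (f \<omega>)"
        using excess_ge f_meas by blast
    qed auto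
    also have "\<dots> \<le> (\<integral>D. excess_risk d (P B) (f D) \<partial>M B)"
      using \<Omega>_fin atoms(1)[OF B] M.finite_measure_axioms excess_int excess_nonneg
      by (intro integral_ge_sum_atoms) auto
    finally show "ereal (real (card T) * p * h / 16) \<le> (SUP P\<in>margin_class d G h.
        ereal (\<integral>D. excess_risk d P (f D) \<partial>(Pi\<^sub>M {..<n} (\<lambda>_. pu_law d e P))))"
      using P_margin[OF B] by (intro SUP_upper2[of "P B"]) (auto simp: M_def)
  qed
qed

section \<open>The two regimes of the margin\<close>

lemma minimax_risk_antimono_margin:
  assumes "h \<le> h'"
  shows "minimax_risk d n e G h' \<le> minimax_risk d n e G h"
proof -
  have "margin_class d G h' \<subseteq> margin_class d G h"
    unfolding margin_class_def using assms by fastforce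
  then show ?thesis
    unfolding minimax_risk_def by (intro INF_mono) (auto intro!: SUP_subset_mono)
qed

text \<open>
  Of the shattered points one plays the role of \<open>z\<close>, whence \<open>V - 1\<close>.  The mass \<open>p\<close> solves
  \<open>n p (2 e\<^sub>m) h\<^sup>2 = 1 / 2\<close>: a larger one would increase the cost \<open>p h\<close> of an error, but the sample would
  begin to reveal the labels.  The hypothesis \<open>large\<close> makes these masses fit into a probability
  distribution.
\<close>

lemma minimax_risk_large_margin:
  fixes h e\<^sub>m :: real
  assumes G: "G \<subseteq> classifiers d" and V: "V \<ge> 1" and n: "n \<ge> 1"
    and h: "0 < h" "h \<le> 1" and e\<^sub>m: "0 < e\<^sub>m"
    and large: "real V \<le> real n * e\<^sub>m * h\<^sup>2"
    and e_meas: "e \<in> borel_measurable (Rd d)"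
    and e_range: "\<And>x. x \<in> space (Rd d) \<Longrightarrow> 0 \<le> e x \<and> e x \<le> 1"
    and shatter: "shattered d G V x" and e_x: "(SUP i\<in>{..<V}. e (x i)) \<le> 2 * e\<^sub>m"
  shows "ereal ((real V - 1) / (64 * (h * real n * e\<^sub>m))) \<le> minimax_risk d n e G h"
proof -
  define T where "T = x ` {..<V} - {x 0}"
  define p where "p = 1 / (4 * (real n * e\<^sub>m * h\<^sup>2))"
  have pos: "0 < real n * e\<^sub>m * h\<^sup>2"
    using n h e\<^sub>m by simp
  have x0: "x 0 \<in> x ` {..<V}"
    using V by auto
  have T: "finite T" "insert (x 0) T = x ` {..<V}"
    using x0 by (auto simp: T_def)
  have card_T: "real (card T) = real V - 1"
    using shattered_set(1)[OF shatter] x0 V by (simp add: T_def of_nat_diff)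
  have "ereal (real (card T) * p * h / 16) \<le> minimax_risk d n e G h"
  proof (rule minimax_risk_lower_bound[OF G T(1) _ _ _ h e_meas e_range, where z = "x 0" and E = "2 * e\<^sub>m"])
    show "x 0 \<notin> T" by (simp add: T_def)
    show "insert (x 0) T \<subseteq> space (Rd d)"
      unfolding T(2) using shatter by (auto simp: shattered_def)
    show "\<exists>g\<in>G. \<forall>u\<in>insert (x 0) T. g u \<longleftrightarrow> u \<in> B" for B
      unfolding T(2) using shatter by (rule shattered_set(2))
    show "e u \<le> 2 * e\<^sub>m" if "u \<in> T" for u
    proof -
      obtain i where i: "i < V" "u = x i" using \<open>u \<in> T\<close> by (auto simp: T_def)
      have "e (x i) \<le> (SUP i\<in>{..<V}. e (x i))"
        using i by (intro cSUP_upper) auto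
      then show ?thesis using e_x i by simp
    qed
    show "0 \<le> p" using pos by (simp add: p_def)
    show "real (card T) * p \<le> 1"
      using pos large by (simp add: card_T p_def field_simps)
    show "real n * (p * (2 * e\<^sub>m) * h\<^sup>2) \<le> 1 / 2"
      using n h e\<^sub>m by (simp add: p_def field_simps)
  qed
  also have "real (card T) * p * h / 16 = (real V - 1) / (64 * (h * real n * e\<^sub>m))"
    using n h e\<^sub>m by (simp add: card_T p_def field_simps power2_eq_square)
  finally show ?thesis .
qed

theorem proposition3:
  shows "\<exists>\<kappa>\<^sub>2 :: real. \<kappa>\<^sub>2 > 0 \<and>
    (\<forall>(d::nat) (G :: (point \<Rightarrow> bool) set) (V::nat) (n::nat) (h::real) (e\<^sub>m::real) (e :: point \<Rightarrow> real).
       G \<subseteq> classifiers d \<longrightarrow>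
       has_VC_dim d G V \<longrightarrow>
       n \<ge> 1 \<longrightarrow> 0 < h \<longrightarrow> h \<le> 1 \<longrightarrow> 0 < e\<^sub>m \<longrightarrow> e\<^sub>m \<le> 1 \<longrightarrow>
       V \<ge> 2 \<longrightarrow> real n * e\<^sub>m \<ge> real V \<longrightarrow>
       e \<in> borel_measurable (Rd d) \<longrightarrow>
       (\<forall>x\<in>space (Rd d). 0 < e x \<and> e x \<le> 1) \<longrightarrow>
       (\<forall>x\<in>space (Rd d). e x \<ge> e\<^sub>m) \<longrightarrow>
       (\<forall>\<epsilon>>0. \<exists>x. shattered d G V x \<and> (SUP i\<in>{..<V}. e (x i)) \<le> e\<^sub>m + \<epsilon>) \<longrightarrow>
       (let h' = sqrt (real V / (real n * e\<^sub>m)) in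
          (h \<ge> h' \<longrightarrow>
             minimax_risk d n e G h \<ge> ereal (\<kappa>\<^sub>2 * ((real V - 1) / (h * real n * e\<^sub>m)))) \<and>
          (h \<le> h' \<longrightarrow>
             minimax_risk d n e G h \<ge> ereal (\<kappa>\<^sub>2 * sqrt ((real V - 1) / (real n * e\<^sub>m))))))"
proof (intro exI[of _ "1 / 128"] conjI allI impI)
  fix d n V :: nat and G :: "(point \<Rightarrow> bool) set" and h e\<^sub>m :: real and e :: "point \<Rightarrow> real"
  assume G: "G \<subseteq> classifiers d" and n: "n \<ge> 1" and h: "0 < h" "h \<le> 1"
    and e\<^sub>m: "0 < e\<^sub>m" and V: "V \<ge> 2" and nV: "real n * e\<^sub>m \<ge> real V"
    and e_meas: "e \<in> borel_measurable (Rd d)"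
    and e_range: "\<forall>x\<in>space (Rd d). 0 < e x \<and> e x \<le> 1"
    and shatter: "\<forall>\<epsilon>>0. \<exists>x. shattered d G V x \<and> (SUP i\<in>{..<V}. e (x i)) \<le> e\<^sub>m + \<epsilon>"
  define N where "N = real n * e\<^sub>m"
  define h' where "h' = sqrt (real V / N)"
  have N: "0 < N" "real V \<le> N" using nV V by (auto simp: N_def)
  \<comment> \<open>\<open>\<epsilon> = e\<^sub>m\<close>: a factor of 2 in the propensity only affects the constant.\<close>
  obtain x where x: "shattered d G V x" "(SUP i\<in>{..<V}. e (x i)) \<le> 2 * e\<^sub>m"
    using shatter e\<^sub>m by (metis mult_2)
  have bound: "ereal ((real V - 1) / (64 * (k * N))) \<le> minimax_risk d n e G k"
    if k: "0 < k" "k \<le> 1" "h' \<le> k" for k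
  proof -
    have "real V / N = h'\<^sup>2" using N by (simp add: h'_def)
    also have "\<dots> \<le> k\<^sup>2" using k(3) N by (intro power_mono) (simp_all add: h'_def)
    finally have "real V \<le> real n * e\<^sub>m * k\<^sup>2"
      using N by (simp add: N_def field_simps)
    then show ?thesis
      using minimax_risk_large_margin[OF G _ n k(1,2) e\<^sub>m _ e_meas _ x] V e_range
      by (simp add: N_def less_imp_le mult.assoc)
  qed
  have h'_pos: "0 < h'" using N V by (simp add: h'_def)
  show "let h' = sqrt (real V / (real n * e\<^sub>m)) in
          (h \<ge> h' \<longrightarrow>
             minimax_risk d n e G h \<ge> ereal (1 / 128 * ((real V - 1) / (h * real n * e\<^sub>m)))) \<and>
          (h \<le> h' \<longrightarrow>
             minimax_risk d n e G h \<ge> ereal (1 / 128 * sqrt ((real V - 1) / (real n * e\<^sub>m))))"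
    unfolding Let_def N_def[symmetric] h'_def[symmetric] mult.assoc
  proof (intro conjI impI)
    assume "h' \<le> h"
    have "ereal (1 / 128 * ((real V - 1) / (h * N))) \<le> ereal ((real V - 1) / (64 * (h * N)))"
      using h V N by (simp add: field_simps)
    also have "\<dots> \<le> minimax_risk d n e G h"
      using h \<open>h' \<le> h\<close> by (rule bound)
    finally show "ereal (1 / 128 * ((real V - 1) / (h * N))) \<le> minimax_risk d n e G h" .
  next
    assume "h \<le> h'"
    \<comment> \<open>A smaller margin only enlarges the class, so the bound at \<open>h'\<close> applies; it has the right
      order since \<open>V \<le> 4 (V - 1)\<close>.\<close>
    have "h' * sqrt ((real V - 1) / N) = sqrt (real V * (real V - 1)) / N"
      unfolding h'_def real_sqrt_mult[symmetric] using N by (simp add: real_sqrt_divide)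
    also have "\<dots> \<le> 2 * (real V - 1) / N"
    proof (intro divide_right_mono real_le_lsqrt)
      have "real V * (real V - 1) \<le> (4 * (real V - 1)) * (real V - 1)"
        using V by (intro mult_right_mono) auto
      also have "\<dots> = (2 * (real V - 1))\<^sup>2"
        by (simp add: power2_eq_square algebra_simps)
      finally show "real V * (real V - 1) \<le> (2 * (real V - 1))\<^sup>2" .
    qed (use V N in auto)
    finally have "1 / 128 * sqrt ((real V - 1) / N) \<le> (real V - 1) / (64 * (h' * N))"
      using h'_pos N by (simp add: field_simps)
    then have "ereal (1 / 128 * sqrt ((real V - 1) / N)) \<le> ereal ((real V - 1) / (64 * (h' * N)))"
      by simp
    also have "\<dots> \<le> minimax_risk d n e G h'"
      using h'_pos N by (intro bound) (simp_all add: h'_def)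
    also have "\<dots> \<le> minimax_risk d n e G h"
      using \<open>h \<le> h'\<close> by (rule minimax_risk_antimono_margin)
    finally show "ereal (1 / 128 * sqrt ((real V - 1) / N)) \<le> minimax_risk d n e G h" .
  qed
qed simp

end
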